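(* Let $d\ge 1$, $A>1$, and let $w:\mathbb{N}\to\mathbb{R}^+$ satisfy $\sum_{j=0}^{+\infty}2^{-dj}\lfloor w(j)\rfloor<+\infty$ (that is, $\mathcal{F}_w^{(d)}$ is an $L^1$-ball of prediction rules). Then for every $\epsilon>0$ there exists $J_\epsilon\in\mathbb{N}$ such that for every $\pi\in\mathcal{P}_{w,A}$, with Bayes rule $f^*$, there exists a function $$f_\epsilon=\sum_{\mathbf{k}\in I_d(J_\epsilon)}B_{\mathbf{k}}^{(J_\epsilon)}\phi_{\mathbf{k}}^{(J_\epsilon)},\qquad B_{\mathbf{k}}^{(J_\epsilon)}\in\{-1,1\},$$ with $d_\pi(f^*,f_\epsilon)\le\epsilon$. For example, $J_\epsilon$ can be taken to be the smallest $J\in\mathbb{N}$ satisfying $\sum_{j=J+1}^{+\infty}2^{-dj}\lfloor w(j)\rfloor<\epsilon/A$.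
   Context: Notation: $\mathbb{N}=\{0,1,2,\dots\}$, $\mathbb{R}^+=[0,\infty)$, $\lambda_d$ is Lebesgue measure on $[0,1]^d$. Dyadic system. For $j\in\mathbb{N}$ let $I_d(j)=\{0,\dots,2^j-1\}^d$. Let $I_k^{(j)}=[k2^{-j},(k+1)2^{-j})$ for $0\le k\le 2^j-2$ and $I_{2^j-1}^{(j)}=[(2^j-1)2^{-j},1]$. For $\mathbf{k}=(k_1,\dots,k_d)\in I_d(j)$ let $\mathcal{I}_{\mathbf{k}}^{(j)}=I_{k_1}^{(j)}\times\dots\times I_{k_d}^{(j)}$ (a dyadic cell of frequency $j$) and $\phi_{\mathbf{k}}^{(j)}=\mathbf{1}_{\mathcal{I}_{\mathbf{k}}^{(j)}}$. Writing convention (W). An expansion $f=\sum_{j\ge0}\sum_{\mathbf{k}\in I_d(j)}a_{\mathbf{k}}^{(j)}\phi_{\mathbf{k}}^{(j)}$ ($\lambda_d$-a.e.; at each point only finitely many terms are nonzero) of a measurable function $f:[0,1]^d\to\{-1,1\}$ with $a_{\mathbf{k}}^{(j)}\in\{-1,0,1\}$ satisfies (W) if: (1) whenever $a_{\mathbf{k}}^{(j)}\ne0$, all coefficients of dyadic cells of higher frequency contained in $\mathcal{I}_{\mathbf{k}}^{(j)}$ are $0$; (2) low frequencies are preferred whenever possible: whenever $f$ is $\lambda_d$-a.e. constant on a dyadic cell, that cell or a dyadic cell containing it has a nonzero coefficient (in particular the $2^d$ subcells of frequency $j+1$ of a cell of frequency $j$ never all carry the same nonzero coefficient). Such an expansion,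 if it exists, is unique. Class $\mathcal{F}_w^{(d)}$: for $w:\mathbb{N}\to\mathbb{R}^+$, the set of functions $f:[0,1]^d\to\{-1,1\}$ admitting an expansion satisfying (W) with $\mathrm{card}\{\mathbf{k}\in I_d(j):a_{\mathbf{k}}^{(j)}\neq0\}\le w(j)$ for all $j\in\mathbb{N}$. Classification. A probability measure $\pi$ on $[0,1]^d\times\{-1,1\}$ is the law of $(X,Y)$; $P^X$ is its marginal on $[0,1]^d$ and $\eta(x)=\mathbb{P}(Y=1\mid X=x)$. A prediction rule is a measurable $f:[0,1]^d\to\{-1,1\}$; its risk is $R(f)=\mathbb{P}(f(X)\ne Y)$. The Bayes rule is $f^*=\mathrm{sign}(2\eta-1)$, with the convention $\mathrm{sign}(0)=1$. For prediction rules $f,g$, $d_\pi(f,g)=|R(f)-R(g)|$. $\mathcal{P}_{w,A}$ is the set of all probability measures $\pi$ on $[0,1]^d\times\{-1,1\}$ such that the Bayes rule $f^*$ belongs to $\mathcal{F}_w^{(d)}$ (i.e. coincides $P^X$-a.s. with an element of it) and $P^X$ is absolutely continuous with respect to $\lambda_d$ with a version of its density bounded above by $A$. *)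

theory Defs
  imports "HOL-Probability.Probability"
begin

text \<open>
  The dimension \<open>d \<ge> 1\<close> is \<open>CARD('d)\<close> for an index type \<open>'d\<close> of class \<open>finite\<close>.  Labels and
  coefficients are real numbers restricted to \<open>{-1, 1}\<close> and \<open>{-1, 0, 1}\<close>.  Functions on
  \<open>[0,1]\<^sup>d\<close> are total functions on \<open>real ^ 'd\<close> whose values outside the cube play no role.
\<close>

abbreviation unit_cube :: "(real ^ 'd::finite) set" where
  "unit_cube \<equiv> cbox 0 1"

definition cube_lborel :: "(real ^ 'd::finite) measure" where
  "cube_lborel = restrict_space lborel unit_cube"

abbreviation labels :: "real measure" where
  "labels \<equiv> count_space {-1, 1}"


subsection \<open>Dyadic system\<close>

definition dyadic_index :: "nat \<Rightarrow> ('d::finite \<Rightarrow> nat) set" where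
  "dyadic_index j = {k. \<forall>i. k i < 2 ^ j}"

definition dyadic_interval :: "nat \<Rightarrow> nat \<Rightarrow> real set" where
  "dyadic_interval j k =
    (if Suc k < 2 ^ j then {real k / 2 ^ j ..< real (Suc k) / 2 ^ j}
     else {real k / 2 ^ j .. 1})"

definition dyadic_cell :: "nat \<Rightarrow> ('d::finite \<Rightarrow> nat) \<Rightarrow> (real ^ 'd) set" where
  "dyadic_cell j k = {x. \<forall>i. x $ i \<in> dyadic_interval j (k i)}"

definition dyadic_phi :: "nat \<Rightarrow> ('d::finite \<Rightarrow> nat) \<Rightarrow> real ^ 'd \<Rightarrow> real" where
  "dyadic_phi j k = indicator (dyadic_cell j k)"


subsection \<open>Expansions and the writing convention\<close>

definition dyadic_expansion ::
  "(real ^ 'd::finite \<Rightarrow> real) \<Rightarrow> (nat \<Rightarrow> ('d \<Rightarrow> nat) \<Rightarrow> real) \<Rightarrow> bool" where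
  "dyadic_expansion f a \<longleftrightarrow>
    (\<forall>j. \<forall>k\<in>dyadic_index j. a j k \<in> {-1, 0, 1}) \<and>
    (\<forall>x\<in>unit_cube. finite {(j, k). k \<in> dyadic_index j \<and> a j k * dyadic_phi j k x \<noteq> 0}) \<and>
    (AE x in cube_lborel. f x = (\<Sum>j. \<Sum>k\<in>dyadic_index j. a j k * dyadic_phi j k x))"

definition writing_convention ::
  "(real ^ 'd::finite \<Rightarrow> real) \<Rightarrow> (nat \<Rightarrow> ('d \<Rightarrow> nat) \<Rightarrow> real) \<Rightarrow> bool" where
  "writing_convention f a \<longleftrightarrow>
    (\<forall>j. \<forall>k\<in>dyadic_index j. a j k \<noteq> 0 \<longrightarrow>
      (\<forall>j'>j. \<forall>k'\<in>dyadic_index j'. dyadic_cell j' k' \<subseteq> dyadic_cell j k \<longrightarrow> a j' k' = 0)) \<and>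
    (\<forall>j. \<forall>k\<in>dyadic_index j.
      (\<exists>c. AE x in cube_lborel. x \<in> dyadic_cell j k \<longrightarrow> f x = c) \<longrightarrow>
      (\<exists>j'. \<exists>k'\<in>dyadic_index j'. dyadic_cell j k \<subseteq> dyadic_cell j' k' \<and> a j' k' \<noteq> 0))"

definition prediction_rule :: "(real ^ 'd::finite \<Rightarrow> real) \<Rightarrow> bool" where
  "prediction_rule f \<longleftrightarrow> f \<in> measurable cube_lborel labels"

definition sparse_class :: "(nat \<Rightarrow> real) \<Rightarrow> (real ^ 'd::finite \<Rightarrow> real) set" where
  "sparse_class w =
    {f. prediction_rule f \<and>
        (\<exists>a. dyadic_expansion f a \<and> writing_convention f a \<and>
             (\<forall>j. real (card {k \<in> dyadic_index j. a j k \<noteq> 0}) \<le> w j))}"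


subsection \<open>Classification\<close>

text \<open>A law \<open>\<pi>\<close> is considered on its canonical space: \<open>X = fst\<close> and \<open>Y = snd\<close>.\<close>

definition classification_law :: "((real ^ 'd::finite) \<times> real) measure \<Rightarrow> bool" where
  "classification_law \<pi> \<longleftrightarrow> prob_space \<pi> \<and> sets \<pi> = sets (cube_lborel \<Otimes>\<^sub>M labels)"

definition marginal_X :: "((real ^ 'd::finite) \<times> real) measure \<Rightarrow> (real ^ 'd) measure" where
  "marginal_X \<pi> = distr \<pi> cube_lborel fst"

definition risk :: "((real ^ 'd::finite) \<times> real) measure \<Rightarrow> (real ^ 'd \<Rightarrow> real) \<Rightarrow> real" where
  "risk \<pi> f = measure \<pi> {z \<in> space \<pi>. f (fst z) \<noteq> snd z}"

definition risk_dist ::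
  "((real ^ 'd::finite) \<times> real) measure \<Rightarrow> (real ^ 'd \<Rightarrow> real) \<Rightarrow> (real ^ 'd \<Rightarrow> real) \<Rightarrow> real" where
  "risk_dist \<pi> f g = \<bar>risk \<pi> f - risk \<pi> g\<bar>"

text \<open>
  \<open>\<eta>\<close> is a version of \<open>x \<mapsto> P(Y = 1 | X = x)\<close>: a measurable function whose composition with \<open>X\<close>
  is a version of the conditional expectation of \<open>1\<^bsub>Y = 1\<^esub>\<close> given the sigma-algebra of \<open>X\<close>.
  Such a version, and hence the Bayes rule, is determined only almost surely.
\<close>

definition regression_function ::
  "((real ^ 'd::finite) \<times> real) measure \<Rightarrow> (real ^ 'd \<Rightarrow> real) \<Rightarrow> bool" where
  "regression_function \<pi> \<eta> \<longleftrightarrow>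
    \<eta> \<in> borel_measurable cube_lborel \<and>
    (AE z in \<pi>. \<eta> (fst z) =
      real_cond_exp \<pi> (vimage_algebra (space \<pi>) fst cube_lborel) (indicator {z. snd z = 1}) z)"

text \<open>Unlike \<^const>\<open>sgn\<close>, this sign takes the value \<open>1\<close> at \<open>0\<close>.\<close>

definition sign :: "real \<Rightarrow> real" where
  "sign t = (if t \<ge> 0 then 1 else -1)"

definition bayes_rule ::
  "((real ^ 'd::finite) \<times> real) measure \<Rightarrow> (real ^ 'd \<Rightarrow> real) \<Rightarrow> bool" where
  "bayes_rule \<pi> f \<longleftrightarrow>
    (\<exists>\<eta>. regression_function \<pi> \<eta> \<and> (\<forall>x\<in>unit_cube. f x = sign (2 * \<eta> x - 1)))"

definition law_class :: "(nat \<Rightarrow> real) \<Rightarrow> real \<Rightarrow> ((real ^ 'd::finite) \<times> real) measure set" where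
  "law_class w A =
    {\<pi>. classification_law \<pi> \<and>
        (\<exists>f g. bayes_rule \<pi> f \<and> g \<in> sparse_class w \<and> (AE x in marginal_X \<pi>. f x = g x)) \<and>
        (\<exists>p. distributed \<pi> cube_lborel fst p \<and> (\<forall>x\<in>unit_cube. p x \<le> ennreal A))}"


subsection \<open>Approximation at one frequency\<close>

definition single_frequency :: "nat \<Rightarrow> (('d::finite \<Rightarrow> nat) \<Rightarrow> real) \<Rightarrow> real ^ 'd \<Rightarrow> real" where
  "single_frequency J B = (\<lambda>x. \<Sum>k\<in>dyadic_index J. B k * dyadic_phi J k x)"

text \<open>
  Every version of the Bayes rule of \<open>\<pi>\<close> is within \<open>\<epsilon>\<close> of a function which is constant,
  equal to \<open>-1\<close> or \<open>1\<close>, on each dyadic cell of frequency \<open>J\<close>.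
\<close>

definition bayes_approximable :: "((real ^ 'd::finite) \<times> real) measure \<Rightarrow> real \<Rightarrow> nat \<Rightarrow> bool" where
  "bayes_approximable \<pi> \<epsilon> J \<longleftrightarrow>
    (\<forall>fstar. bayes_rule \<pi> fstar \<longrightarrow>
      (\<exists>B. (\<forall>k\<in>dyadic_index J. B k \<in> {-1, 1}) \<and>
           risk_dist \<pi> fstar (single_frequency J B) \<le> \<epsilon>))"

definition scaled_count :: "nat \<Rightarrow> (nat \<Rightarrow> real) \<Rightarrow> nat \<Rightarrow> real" where
  "scaled_count d w j = real_of_int \<lfloor>w j\<rfloor> / 2 ^ (d * j)"

definition scaled_count_tail :: "nat \<Rightarrow> (nat \<Rightarrow> real) \<Rightarrow> nat \<Rightarrow> real" where
  "scaled_count_tail d w J = (\<Sum>j. scaled_count d w (j + (J + 1)))"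

end

theory Submission
  imports Defs
begin

text \<open>
  Truncate the expansion of the Bayes rule at frequency \<open>J\<close>, filling the uncovered cells with the
  label \<open>1\<close>.  The result differs from the Bayes rule only on the cells of frequency above \<open>J\<close>
  carrying a nonzero coefficient, whose total Lebesgue measure is at most the tail of the series;
  the density bound turns this into at most \<open>A\<close> times the tail under the law of \<open>X\<close>.
\<close>

subsection \<open>Dyadic cells\<close>

text \<open>The minimum accounts for the point \<open>1\<close>, which belongs to the last interval.\<close>

definition dyadic_position :: "nat \<Rightarrow> real \<Rightarrow> nat" where
  "dyadic_position j t = min (nat \<lfloor>2 ^ j * t\<rfloor>) (2 ^ j - 1)"

lemma dyadic_position_less: "dyadic_position j t < 2 ^ j"
  unfolding dyadic_position_def by (rule le_less_trans[OF min.cobounded2]) simp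

lemma dyadic_position_below_1:
  assumes "0 \<le> t" "t < 1"
  shows "dyadic_position j t = nat \<lfloor>2 ^ j * t\<rfloor>"
proof -
  have "2 ^ j * t < 2 ^ j" using assms by simp
  hence "\<lfloor>2 ^ j * t\<rfloor> < 2 ^ j" by (simp add: floor_less_iff)
  hence "nat \<lfloor>2 ^ j * t\<rfloor> < 2 ^ j" using assms by (simp add: nat_less_iff)
  thus ?thesis unfolding dyadic_position_def by linarith
qed

lemma dyadic_position_1: "dyadic_position j 1 = 2 ^ j - 1"
  by (simp add: dyadic_position_def nat_power_eq)

text \<open>For t < 1 the cap in \<open>dyadic_position\<close> is inactive, and both sides say that
  the floor of 2^j t is k. At t = 1 the cap gives 2^j - 1, the index of the only interval closed on
  the right.\<close>

lemma mem_dyadic_interval_iff: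
  assumes "0 \<le> t" "t \<le> 1" "k < 2 ^ j"
  shows "t \<in> dyadic_interval j k \<longleftrightarrow> dyadic_position j t = k"
proof (cases "t = 1")
  case True
  have "real (Suc k) < 2 ^ j" if "Suc k < 2 ^ j"
    using that by (metis of_nat_less_iff of_nat_numeral of_nat_power)
  moreover have "real k \<le> 2 ^ j"
    using assms(3) by (metis less_imp_le of_nat_le_iff of_nat_numeral of_nat_power)
  ultimately show ?thesis
    using True assms(3) by (auto simp: dyadic_position_1 dyadic_interval_def field_simps)
next
  case False
  hence t: "t < 1" using assms by simp
  have "dyadic_position j t = k \<longleftrightarrow> \<lfloor>2 ^ j * t\<rfloor> = int k"
    using assms t by (auto simp: dyadic_position_below_1)
  also have "\<dots> \<longleftrightarrow> real k \<le> 2 ^ j * t \<and> 2 ^ j * t < real k + 1"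
    by (simp add: floor_eq_iff)
  also have "\<dots> \<longleftrightarrow> t \<in> dyadic_interval j k"
  proof (cases "Suc k < 2 ^ j")
    case True
    thus ?thesis by (auto simp: dyadic_interval_def field_simps)
  next
    case F: False
    hence "Suc k = 2 ^ j" using assms(3) by simp
    \<comment> \<open>The right end (k + 1) / 2^j of the last interval is 1, and t < 1 makes the
      closed endpoint irrelevant.\<close>
    hence "real k + 1 = 2 ^ j" by (metis of_nat_Suc of_nat_numeral of_nat_power add.commute)
    thus ?thesis using F t assms by (auto simp: dyadic_interval_def field_simps)
  qed
  finally show ?thesis by simp
qed

text \<open>Cells are nested: dropping the last J - j binary digits of a position at frequency J
  gives the position at frequency j. For t < 1 this is the floor of a real quotient with integer
  divisor; t = 1 is computed from the capped values.\<close>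

lemma dyadic_position_coarsen:
  assumes "j \<le> J" "0 \<le> t" "t \<le> 1"
  shows "dyadic_position j t = dyadic_position J t div 2 ^ (J - j)"
proof -
  have pow: "(2::nat) ^ J = 2 ^ j * 2 ^ (J - j)"
    using assms(1) by (simp flip: power_add)
  show ?thesis
  proof (cases "t = 1")
    case True
    \<comment> \<open>Division with remainder: the quotient 2^j - 1 is the capped position at
      frequency j.\<close>
    have "(2::nat) ^ J - 1 = (2 ^ j - 1) * 2 ^ (J - j) + (2 ^ (J - j) - 1)"
      by (simp add: pow algebra_simps)
    moreover have "(q * n + (n - 1)) div n = q" if "n > 0" for q n :: nat
      using that by (subst div_mult_self3) auto
    ultimately show ?thesis by (simp only: True dyadic_position_1 zero_less_power zero_less_numeral)
  next
    case False
    have "(2::real) ^ J = 2 ^ j * 2 ^ (J - j)"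
      using assms(1) by (simp flip: power_add)
    hence "2 ^ j * t = (2 ^ J * t) / real_of_int (2 ^ (J - j))"
      by simp
    also have "\<lfloor>\<dots>\<rfloor> = \<lfloor>2 ^ J * t\<rfloor> div 2 ^ (J - j)"
      by (rule floor_divide_real_eq_div) simp
    finally have "nat \<lfloor>2 ^ j * t\<rfloor> = nat \<lfloor>2 ^ J * t\<rfloor> div nat (2 ^ (J - j))"
      using assms(2) by (simp only:) (rule nat_div_distrib, simp)
    moreover have "nat (2 ^ (J - j)) = 2 ^ (J - j)"
      by (simp add: nat_power_eq)
    moreover have "t < 1" using False assms(3) by simp
    ultimately show ?thesis
      by (simp only: dyadic_position_below_1[OF assms(2)])
  qed
qed

lemma mem_unit_cube_iff: "x \<in> unit_cube \<longleftrightarrow> (\<forall>i. 0 \<le> x $ i \<and> x $ i \<le> 1)"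
  by (simp add: mem_box_cart)

text \<open>Membership becomes an equality of index vectors, so each point of the cube lies in
  exactly one cell of each frequency.\<close>

lemma mem_dyadic_cell_iff:
  assumes "x \<in> unit_cube" "k \<in> dyadic_index j"
  shows "x \<in> dyadic_cell j k \<longleftrightarrow> (\<lambda>i. dyadic_position j (x $ i)) = k"
proof -
  have "x $ i \<in> dyadic_interval j (k i) \<longleftrightarrow> dyadic_position j (x $ i) = k i" for i
    using assms by (intro mem_dyadic_interval_iff) (auto simp: mem_unit_cube_iff dyadic_index_def)
  thus ?thesis by (auto simp: dyadic_cell_def)
qed

lemma dyadic_position_index: "(\<lambda>i. dyadic_position j (x $ i)) \<in> dyadic_index j"
  by (simp add: dyadic_index_def dyadic_position_less)

lemma finite_dyadic_index: "finite (dyadic_index j :: ('d::finite \<Rightarrow> nat) set)"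
proof -
  have "dyadic_index j = (\<Pi>\<^sub>E i\<in>(UNIV :: 'd set). {..<2 ^ j})"
    by (auto simp: dyadic_index_def PiE_UNIV_domain)
  thus ?thesis by (simp add: finite_PiE)
qed

text \<open>Passing to closed intervals of length 2^(-j) removes the special role of the last
  interval, whose endpoint 1 is (k + 1) / 2^j.\<close>

lemma dyadic_interval_subset:
  assumes "k < 2 ^ j"
  shows "dyadic_interval j k \<subseteq> {real k / 2 ^ j .. (real k + 1) / 2 ^ j}"
proof -
  have "real k + 1 = 2 ^ j" if "\<not> Suc k < 2 ^ j"
  proof -
    have "Suc k = 2 ^ j" using that assms by simp
    thus ?thesis by (metis of_nat_Suc of_nat_numeral of_nat_power add.commute)
  qed
  thus ?thesis by (auto simp: dyadic_interval_def field_simps)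
qed

lemma dyadic_cell_subset_cbox:
  fixes k :: "'d::finite \<Rightarrow> nat"
  assumes "k \<in> dyadic_index j"
  shows "dyadic_cell j k \<subseteq> cbox (\<chi> i. real (k i) / 2 ^ j) (\<chi> i. (real (k i) + 1) / 2 ^ j)"
proof -
  have "dyadic_interval j (k i) \<subseteq> {real (k i) / 2 ^ j .. (real (k i) + 1) / 2 ^ j}" for i
    using assms by (intro dyadic_interval_subset) (simp add: dyadic_index_def)
  thus ?thesis unfolding dyadic_cell_def by (auto simp: mem_box_cart subset_iff)
qed

lemma dyadic_cell_subset_unit_cube:
  assumes "k \<in> dyadic_index j"
  shows "dyadic_cell j k \<subseteq> unit_cube"
proof
  fix x assume "x \<in> dyadic_cell j k"
  hence x: "x $ i \<in> dyadic_interval j (k i)" for i by (simp add: dyadic_cell_def)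
  have "0 \<le> x $ i \<and> x $ i \<le> 1" for i
  proof -
    have ki: "Suc (k i) \<le> 2 ^ j" using assms by (simp add: dyadic_index_def Suc_leI)
    hence "real (Suc (k i)) \<le> 2 ^ j" by (metis of_nat_le_iff of_nat_numeral of_nat_power)
    hence 1: "(real (k i) + 1) / 2 ^ j \<le> 1" by (simp add: field_simps)
    have "real (k i) / 2 ^ j \<le> x $ i" "x $ i \<le> (real (k i) + 1) / 2 ^ j"
      using dyadic_interval_subset[of "k i" j] x[of i] ki by auto
    with 1 show ?thesis by (meson divide_nonneg_nonneg of_nat_0_le_iff order_trans zero_le_power zero_le_numeral)
  qed
  thus "x \<in> unit_cube" by (simp add: mem_unit_cube_iff)
qed

section \<open>Measurability and volume of the cells\<close>

lemma dyadic_cell_borel: "dyadic_cell j k \<in> sets borel"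
proof -
  have "dyadic_interval j n \<in> sets borel" for n by (simp add: dyadic_interval_def)
  hence "{x \<in> space borel. x $ i \<in> dyadic_interval j (k i)} \<in> sets borel" for i :: 'a
    by measurable
  hence "(\<Inter>i. {x \<in> space borel. x $ i \<in> dyadic_interval j (k i)}) \<in> sets borel"
    by (intro sets.finite_INT) auto
  also have "(\<Inter>i. {x \<in> space borel. x $ i \<in> dyadic_interval j (k i)}) = dyadic_cell j k"
    by (auto simp: dyadic_cell_def)
  finally show ?thesis .
qed

lemma space_cube_lborel [simp]: "space cube_lborel = unit_cube"
  by (simp add: cube_lborel_def space_restrict_space)

lemma finite_measure_cube_lborel: "finite_measure cube_lborel"
  by (rule finite_measureI)
     (simp add: cube_lborel_def space_restrict_space emeasure_restrict_space emeasure_lborel_cbox_eq)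

lemma dyadic_cell_sets:
  assumes "k \<in> dyadic_index j"
  shows "dyadic_cell j k \<in> sets cube_lborel"
  using dyadic_cell_borel[of j k] dyadic_cell_subset_unit_cube[OF assms]
  by (simp add: cube_lborel_def sets_restrict_space_iff)

text \<open>The enclosing closed box has all sides of length 2^(-j), and its volume is the product
  of the sides.\<close>

lemma measure_dyadic_cell_le:
  fixes k :: "'d::finite \<Rightarrow> nat"
  assumes "k \<in> dyadic_index j"
  shows "measure cube_lborel (dyadic_cell j k) \<le> 1 / 2 ^ (CARD('d) * j)"
proof -
  let ?a = "(\<chi> i. real (k i) / 2 ^ j) :: real ^ 'd" and ?b = "(\<chi> i. (real (k i) + 1) / 2 ^ j) :: real ^ 'd"
  have "measure cube_lborel (dyadic_cell j k) = measure lborel (dyadic_cell j k)"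
    unfolding cube_lborel_def
    by (rule measure_restrict_space) (use assms dyadic_cell_subset_unit_cube in auto)
  also have "\<dots> \<le> measure lborel (cbox ?a ?b)"
    by (rule measure_mono_fmeasurable)
       (use dyadic_cell_subset_cbox[OF assms] dyadic_cell_borel in auto)
  also have "\<dots> = (\<Prod>i\<in>(UNIV :: 'd set). 1 / 2 ^ j)"
  proof -
    have le: "?a $ i \<le> ?b $ i" for i by (simp add: divide_right_mono)
    have "cbox ?a ?b \<noteq> {}" using le by (simp add: interval_ne_empty_cart)
    hence "measure lborel (cbox ?a ?b) = (\<Prod>i\<in>UNIV. ?b $ i - ?a $ i)"
      by (rule content_cbox_cart)
    thus ?thesis by (simp add: field_simps)
  qed
  also have "\<dots> = 1 / 2 ^ (CARD('d) * j)"
    by (simp add: power_divide mult.commute flip: power_mult)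
  finally show ?thesis .
qed


subsection \<open>Truncated expansions\<close>

text \<open>Only the cell containing x contributes, so sums over cells reduce to a single
  coefficient.\<close>

lemma sum_dyadic_phi:
  assumes "x \<in> unit_cube"
  shows "(\<Sum>k\<in>dyadic_index j. c k * dyadic_phi j k x) = c (\<lambda>i. dyadic_position j (x $ i))"
proof -
  let ?q = "\<lambda>i. dyadic_position j (x $ i)"
  have "(\<Sum>k\<in>dyadic_index j. c k * dyadic_phi j k x) = (\<Sum>k\<in>dyadic_index j. if ?q = k then c k else 0)"
    using assms by (intro sum.cong) (auto simp: dyadic_phi_def indicator_def mem_dyadic_cell_iff)
  also have "\<dots> = c ?q"
    using sum.delta'[OF finite_dyadic_index[of j], of ?q c] by (simp add: dyadic_position_index)
  finally show ?thesis .
qed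

lemma single_frequency_eq:
  "x \<in> unit_cube \<Longrightarrow> single_frequency J B x = B (\<lambda>i. dyadic_position J (x $ i))"
  by (simp add: single_frequency_def sum_dyadic_phi)

lemma single_frequency_measurable:
  "single_frequency J B \<in> borel_measurable cube_lborel"
  unfolding single_frequency_def dyadic_phi_def
  by (intro borel_measurable_sum borel_measurable_times borel_measurable_const
      borel_measurable_indicator dyadic_cell_sets)

text \<open>
  \<open>\<lambda>i. k i div 2 ^ (J - j)\<close> indexes the cell of frequency \<open>j\<close> containing the cell \<open>k\<close> of frequency \<open>J\<close>.
\<close>

definition truncation_coeff ::
  "(nat \<Rightarrow> ('d::finite \<Rightarrow> nat) \<Rightarrow> real) \<Rightarrow> nat \<Rightarrow> ('d \<Rightarrow> nat) \<Rightarrow> real" where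
  "truncation_coeff a J k = (if (\<Sum>j\<le>J. a j (\<lambda>i. k i div 2 ^ (J - j))) = -1 then -1 else 1)"

text \<open>By nesting, the sum inside \<open>truncation_coeff\<close> is the partial sum of the
  expansion at x up to frequency J. Testing it against -1 yields a label in every case; in
  particular the value 0 of an uncovered cell becomes 1.\<close>

lemma single_frequency_truncation:
  assumes "x \<in> unit_cube"
  shows "single_frequency J (truncation_coeff a J) x =
    (if (\<Sum>j\<le>J. a j (\<lambda>i. dyadic_position j (x $ i))) = -1 then -1 else 1)"
proof -
  have "(\<Sum>j\<le>J. a j (\<lambda>i. dyadic_position J (x $ i) div 2 ^ (J - j))) =
      (\<Sum>j\<le>J. a j (\<lambda>i. dyadic_position j (x $ i)))"
    using assms by (intro sum.cong) (simp_all add: mem_unit_cube_iff flip: dyadic_position_coarsen)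
  thus ?thesis using assms by (simp add: single_frequency_eq truncation_coeff_def)
qed

text \<open>The exceptional set of the truncation. The shift by J + 1 matches the indexing of
  \<open>scaled_count_tail\<close>.\<close>

definition fine_support ::
  "(nat \<Rightarrow> ('d::finite \<Rightarrow> nat) \<Rightarrow> real) \<Rightarrow> nat \<Rightarrow> (real ^ 'd) set" where
  "fine_support a J =
    (\<Union>j. \<Union>k\<in>{k \<in> dyadic_index (j + (J + 1)). a (j + (J + 1)) k \<noteq> 0}. dyadic_cell (j + (J + 1)) k)"

text \<open>Outside the exceptional set, the cells of frequency above J containing x have
  coefficient 0, so the series at x is its partial sum up to J. As this sum is the label y, the test
  against -1 returns y.\<close>

lemma truncation_eq_outside_fine_support:
  assumes x: "x \<in> unit_cube" "x \<notin> fine_support a J"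
    and sum: "y = (\<Sum>j. \<Sum>k\<in>dyadic_index j. a j k * dyadic_phi j k x)" and y: "y \<in> {-1, 1}"
  shows "single_frequency J (truncation_coeff a J) x = y"
proof -
  have "a j (\<lambda>i. dyadic_position j (x $ i)) = 0" if "j \<notin> {..J}" for j
  proof (rule ccontr)
    let ?q = "\<lambda>i. dyadic_position j (x $ i)"
    assume nz: "a j ?q \<noteq> 0"
    \<comment> \<open>Since j > J, the natural subtraction is exact and j has the shifted form used
      in \<open>fine_support\<close>.\<close>
    have "j = (j - (J + 1)) + (J + 1)" using that by simp
    then obtain n where n: "j = n + (J + 1)" by blast
    have "x \<in> dyadic_cell j ?q"
      using x(1) dyadic_position_index[of j x] by (simp add: mem_dyadic_cell_iff)
    hence "x \<in> fine_support a J"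
      using nz dyadic_position_index[of j x] unfolding fine_support_def n by blast
    thus False using x by simp
  qed
  hence "(\<Sum>j. a j (\<lambda>i. dyadic_position j (x $ i))) = (\<Sum>j\<le>J. a j (\<lambda>i. dyadic_position j (x $ i)))"
    by (intro suminf_finite) auto
  hence "y = (\<Sum>j\<le>J. a j (\<lambda>i. dyadic_position j (x $ i)))"
    unfolding sum sum_dyadic_phi[OF x(1)] .
  with y show ?thesis by (auto simp: single_frequency_truncation[OF x(1)])
qed

lemma fine_support_sets: "fine_support a J \<in> sets cube_lborel"
  unfolding fine_support_def
proof (intro sets.countable_UN'[of UNIV] subsetI)
  fix S assume "S \<in> range (\<lambda>j. \<Union>k\<in>{k \<in> dyadic_index (j + (J + 1)). a (j + (J + 1)) k \<noteq> 0}.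
    dyadic_cell (j + (J + 1)) k)"
  then obtain j where S: "S = (\<Union>k\<in>{k \<in> dyadic_index j. a j k \<noteq> 0}. dyadic_cell j k)" by blast
  show "S \<in> sets cube_lborel"
    unfolding S by (rule sets.finite_UN) (simp_all add: finite_dyadic_index dyadic_cell_sets)
qed simp

text \<open>Two union bounds: over the cells with nonzero coefficient at one frequency, each of
  volume at most 2^(-dj), and then over the frequencies above J.\<close>

lemma measure_fine_support_le:
  fixes a :: "nat \<Rightarrow> ('d::finite \<Rightarrow> nat) \<Rightarrow> real"
  assumes card: "\<And>j. real (card {k \<in> dyadic_index j. a j k \<noteq> 0}) \<le> w j"
    and summable: "summable (scaled_count CARD('d) w)"
  shows "measure cube_lborel (fine_support a J) \<le> scaled_count_tail CARD('d) w J"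
proof -
  interpret finite_measure "cube_lborel :: (real ^ 'd) measure" by (rule finite_measure_cube_lborel)
  define S where "S j = {k \<in> dyadic_index j. a j k \<noteq> 0}" for j
  define U where "U j = (\<Union>k\<in>S j. dyadic_cell j k)" for j
  have fin: "finite (S j)" for j by (simp add: S_def finite_dyadic_index)
  have U_sets: "U j \<in> sets cube_lborel" for j
    unfolding U_def using fin by (intro sets.finite_UN) (auto simp: S_def dyadic_cell_sets)
  have le: "measure cube_lborel (U j) \<le> scaled_count CARD('d) w j" for j
  proof -
    have "measure cube_lborel (U j) \<le> (\<Sum>k\<in>S j. measure cube_lborel (dyadic_cell j k))"
      unfolding U_def by (rule finite_measure_subadditive_finite) (use fin in \<open>auto simp: S_def dyadic_cell_sets\<close>)
    also have "\<dots> \<le> (\<Sum>k\<in>S j. 1 / 2 ^ (CARD('d) * j))"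
      by (intro sum_mono measure_dyadic_cell_le) (simp add: S_def)
    also have "\<dots> = real (card (S j)) / 2 ^ (CARD('d) * j)" by simp
    also have "\<dots> \<le> scaled_count CARD('d) w j"
    proof -
      \<comment> \<open>A cardinality is an integer, so the bound \<open>w j\<close> sharpens to its
        floor.\<close>
      have "int (card (S j)) \<le> \<lfloor>w j\<rfloor>" using card[of j] by (simp add: S_def le_floor_iff)
      hence "real (card (S j)) \<le> real_of_int \<lfloor>w j\<rfloor>" by linarith
      thus ?thesis by (simp add: scaled_count_def divide_right_mono)
    qed
    finally show ?thesis .
  qed
  have tail: "summable (\<lambda>j. scaled_count CARD('d) w (j + (J + 1)))"
    using summable by (simp only: summable_iff_shift)
  \<comment> \<open>Summability is obtained first by comparison: countable subadditivity and the
    termwise comparison of the series both rely on it.\<close>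
  have sU: "summable (\<lambda>j. measure cube_lborel (U (j + (J + 1))))"
    by (rule summable_comparison_test'[OF tail, of 0]) (use le in auto)
  have "measure cube_lborel (\<Union>j. U (j + (J + 1))) \<le> (\<Sum>j. measure cube_lborel (U (j + (J + 1))))"
    using U_sets sU by (intro finite_measure_subadditive_countably) auto
  also have "\<dots> \<le> scaled_count_tail CARD('d) w J"
    unfolding scaled_count_tail_def using le sU tail by (intro suminf_le) auto
  finally show ?thesis by (simp add: fine_support_def U_def S_def)
qed


subsection \<open>Risks\<close>

text \<open>Where one rule errs and the other does not, the two differ, so almost surely the point
  lies in E. This bounds each risk by the other plus the measure of E; using both orders gives the
  absolute value.\<close>

lemma risk_dist_le:
  assumes "prob_space \<pi>"
    and "{z \<in> space \<pi>. f (fst z) \<noteq> snd z} \<in> sets \<pi>" "{z \<in> space \<pi>. g (fst z) \<noteq> snd z} \<in> sets \<pi>"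
    and "E \<in> sets \<pi>" and "AE z in \<pi>. f (fst z) \<noteq> g (fst z) \<longrightarrow> z \<in> E"
  shows "risk_dist \<pi> f g \<le> measure \<pi> E"
proof -
  interpret prob_space \<pi> by fact
  have *: "risk \<pi> u \<le> risk \<pi> v + measure \<pi> E"
    if "{z \<in> space \<pi>. u (fst z) \<noteq> snd z} \<in> sets \<pi>" "{z \<in> space \<pi>. v (fst z) \<noteq> snd z} \<in> sets \<pi>"
      "AE z in \<pi>. u (fst z) \<noteq> v (fst z) \<longrightarrow> z \<in> E" for u v
  proof -
    have "risk \<pi> u \<le> measure \<pi> ({z \<in> space \<pi>. v (fst z) \<noteq> snd z} \<union> E)"
      unfolding risk_def using that assms(4) by (intro finite_measure_mono_AE) auto
    also have "\<dots> \<le> risk \<pi> v + measure \<pi> E"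
      unfolding risk_def using that assms(4) by (intro measure_Un_le) auto
    finally show ?thesis .
  qed
  have "AE z in \<pi>. g (fst z) \<noteq> f (fst z) \<longrightarrow> z \<in> E" using assms(5) by auto
  thus ?thesis using *[of f g] *[of g f] assms by (auto simp: risk_dist_def)
qed

lemma space_classification_law:
  "classification_law \<pi> \<Longrightarrow> space \<pi> = unit_cube \<times> {-1, 1}"
  using sets_eq_imp_space_eq[of \<pi> "cube_lborel \<Otimes>\<^sub>M labels"]
  by (simp add: classification_law_def space_pair_measure)

lemma error_event_sets:
  assumes "classification_law \<pi>" "f \<in> borel_measurable cube_lborel"
  shows "{z \<in> space \<pi>. f (fst z) \<noteq> snd z} \<in> sets \<pi>"
proof -
  have [measurable_cong]: "sets \<pi> = sets (cube_lborel \<Otimes>\<^sub>M labels)"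
    using assms by (simp add: classification_law_def)
  note [measurable] = assms(2)
  \<comment> \<open>\<open>snd\<close> is measurable into the discrete label space; composing with
    the inclusion into the reals makes it comparable with f.\<close>
  have "(\<lambda>z. snd z) \<in> measurable \<pi> labels" by measurable
  hence [measurable]: "snd \<in> borel_measurable \<pi>"
    using measurable_compose[of snd \<pi> labels "\<lambda>x. x" borel] by simp
  show ?thesis by measurable
qed

lemma bayes_rule_measurable:
  assumes "bayes_rule \<pi> f"
  shows "f \<in> borel_measurable cube_lborel"
proof -
  from assms obtain \<eta> where [measurable]: "\<eta> \<in> borel_measurable cube_lborel"
    and f: "\<forall>x\<in>unit_cube. f x = sign (2 * \<eta> x - 1)"
    by (auto simp: bayes_rule_def regression_function_def)
  have "(\<lambda>x. sign (2 * \<eta> x - 1)) \<in> borel_measurable cube_lborel"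
    unfolding sign_def by measurable
  thus ?thesis using f by (subst measurable_cong) auto
qed

text \<open>Both regression functions are versions of one conditional expectation, so they and their
  signs agree almost surely. This carries the expansion, known for one Bayes rule, over to every
  version.\<close>

lemma bayes_rule_unique:
  assumes "classification_law \<pi>" "bayes_rule \<pi> f" "bayes_rule \<pi> f'"
  shows "AE z in \<pi>. f (fst z) = f' (fst z)"
proof -
  from assms(2) obtain \<eta> where \<eta>: "regression_function \<pi> \<eta>"
    "\<forall>x\<in>unit_cube. f x = sign (2 * \<eta> x - 1)" by (auto simp: bayes_rule_def)
  from assms(3) obtain \<eta>' where \<eta>': "regression_function \<pi> \<eta>'"
    "\<forall>x\<in>unit_cube. f' x = sign (2 * \<eta>' x - 1)" by (auto simp: bayes_rule_def)
  have "AE z in \<pi>. \<eta> (fst z) = \<eta>' (fst z)"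
    using \<eta>(1) \<eta>'(1) by (auto simp: regression_function_def)
  moreover have "AE z in \<pi>. fst z \<in> unit_cube"
    using space_classification_law[OF assms(1)] by (intro AE_I2) auto
  ultimately show ?thesis
    by eventually_elim (simp only: \<eta>(2)[rule_format] \<eta>'(2)[rule_format])
qed

text \<open>The probability is the integral of the density over S, and the density is at most A
  there.\<close>

lemma measure_marginal_le:
  assumes "classification_law \<pi>" and dist: "distributed \<pi> cube_lborel fst p"
    and p: "\<forall>x\<in>unit_cube. p x \<le> ennreal A" and "0 \<le> A" and S: "S \<in> sets cube_lborel"
  shows "measure \<pi> {z \<in> space \<pi>. fst z \<in> S} \<le> A * measure cube_lborel S"
proof -
  interpret prob_space \<pi> using assms(1) by (simp add: classification_law_def)
  have "emeasure \<pi> {z \<in> space \<pi>. fst z \<in> S} = (\<integral>\<^sup>+x. p x * indicator S x \<partial>cube_lborel)"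
    using distributed_emeasure[OF dist S] by (simp add: vimage_def Int_def conj_commute)
  also have "\<dots> \<le> (\<integral>\<^sup>+x. ennreal A * indicator S x \<partial>cube_lborel)"
    using p by (intro nn_integral_mono mult_right_mono) auto
  also have "\<dots> = ennreal A * emeasure cube_lborel S"
    using S by (rule nn_integral_cmult_indicator)
  also have "\<dots> = ennreal (A * measure cube_lborel S)"
    using \<open>0 \<le> A\<close>
    by (simp add: finite_measure.emeasure_eq_measure[OF finite_measure_cube_lborel] ennreal_mult)
  finally show ?thesis using \<open>0 \<le> A\<close> by (simp add: emeasure_eq_measure)
qed

text \<open>Absolute continuity of the law of X: Lebesgue null sets are null for it. The expansion,
  valid only up to a Lebesgue null set, thus holds almost surely at X.\<close>

lemma AE_law_of_AE_cube_lborel: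
  assumes "distributed \<pi> cube_lborel fst p" and "AE x in cube_lborel. Q x"
  shows "AE z in \<pi>. Q (fst z)"
proof -
  have "AE x in density cube_lborel p. Q x"
    using assms(2) by (auto simp: AE_density[OF distributed_borel_measurable[OF assms(1)]])
  hence "AE x in distr \<pi> cube_lborel fst. Q x"
    unfolding distributed_distr_eq_density[OF assms(1)] .
  thus ?thesis by (rule AE_distrD[OF distributed_measurable[OF assms(1)]])
qed

section \<open>Approximation of the Bayes rule at one frequency\<close>

lemma law_class_bayes_approximable:
  fixes \<pi> :: "((real ^ 'd::finite) \<times> real) measure"
  assumes \<pi>: "\<pi> \<in> law_class w A" and "A > 0" and summable: "summable (scaled_count CARD('d) w)"
    and tail: "scaled_count_tail CARD('d) w J \<le> \<epsilon> / A"
  shows "bayes_approximable \<pi> \<epsilon> J"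
  unfolding bayes_approximable_def
proof (intro allI impI)
  fix fstar assume fstar: "bayes_rule \<pi> fstar"
  from \<pi> obtain f g p where law: "classification_law \<pi>" and f: "bayes_rule \<pi> f"
    and g: "g \<in> sparse_class w" and fg: "AE x in marginal_X \<pi>. f x = g x"
    and p: "distributed \<pi> cube_lborel fst p" "\<forall>x\<in>unit_cube. p x \<le> ennreal A"
    by (auto simp: law_class_def)
  from g obtain a where pred: "prediction_rule g" and a: "dyadic_expansion g a"
    and card: "\<And>j. real (card {k \<in> dyadic_index j. a j k \<noteq> 0}) \<le> w j"
    by (auto simp: sparse_class_def)
  let ?B = "truncation_coeff a J"
  let ?E = "{z \<in> space \<pi>. fst z \<in> fine_support a J}"
  have AE_g: "AE z in \<pi>. f (fst z) = g (fst z)"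
    using fg unfolding marginal_X_def by (rule AE_distrD[OF distributed_measurable[OF p(1)]])
  have expansion: "AE z in \<pi>. g (fst z) = (\<Sum>j. \<Sum>k\<in>dyadic_index j. a j k * dyadic_phi j k (fst z))"
    using a by (intro AE_law_of_AE_cube_lborel[OF p(1)]) (simp add: dyadic_expansion_def)
  \<comment> \<open>Almost surely \<open>fstar\<close>, f, g and the expansion agree at X; outside
    \<open>fine_support\<close> the truncation takes this same value.\<close>
  have "AE z in \<pi>. fstar (fst z) \<noteq> single_frequency J ?B (fst z) \<longrightarrow> z \<in> ?E"
    using bayes_rule_unique[OF law fstar f] AE_g expansion AE_space[of \<pi>]
  proof eventually_elim
    case (elim z)
    have x: "fst z \<in> unit_cube"
      using elim(4) by (simp only: space_classification_law[OF law] mem_Times_iff)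
    have "g (fst z) \<in> {-1, 1}"
      using measurable_space[OF pred[unfolded prediction_rule_def]] x
      by (simp only: space_cube_lborel space_count_space)
    hence "single_frequency J ?B (fst z) = g (fst z)" if "fst z \<notin> fine_support a J"
      using that by (intro truncation_eq_outside_fine_support[OF x _ elim(3)])
    hence "fst z \<in> fine_support a J" if "fstar (fst z) \<noteq> single_frequency J ?B (fst z)"
      using that elim(1,2) by metis
    with elim(4) show ?case by simp
  qed
  moreover have E: "?E \<in> sets \<pi>"
    using measurable_sets[OF distributed_measurable[OF p(1)] fine_support_sets[of a J]]
    by (simp add: vimage_def Int_def conj_commute)
  ultimately have "risk_dist \<pi> fstar (single_frequency J ?B) \<le> measure \<pi> ?E"
    using law error_event_sets[OF law] bayes_rule_measurable[OF fstar] single_frequency_measurable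
    by (intro risk_dist_le) (auto simp: classification_law_def)
  also have "\<dots> \<le> A * measure cube_lborel (fine_support a J)"
    using \<open>A > 0\<close> by (intro measure_marginal_le[OF law p]) (auto simp: fine_support_sets)
  also have "\<dots> \<le> A * scaled_count_tail CARD('d) w J"
    using \<open>A > 0\<close> measure_fine_support_le[OF card summable] by (intro mult_left_mono) auto
  also have "\<dots> \<le> \<epsilon>" using tail \<open>A > 0\<close> by (simp add: field_simps)
  finally have "risk_dist \<pi> fstar (single_frequency J ?B) \<le> \<epsilon>" .
  moreover have "\<forall>k\<in>dyadic_index J. ?B k \<in> {-1, 1}" by (simp add: truncation_coeff_def)
  ultimately show "\<exists>B. (\<forall>k\<in>dyadic_index J. B k \<in> {-1, 1}) \<and>
      risk_dist \<pi> fstar (single_frequency J B) \<le> \<epsilon>" by blast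
qed

lemma scaled_count_tail_tendsto_0:
  assumes "summable (scaled_count d w)"
  shows "scaled_count_tail d w \<longlonglongrightarrow> 0"
proof -
  have "(\<lambda>n. \<Sum>j. scaled_count d w (j + n)) \<longlonglongrightarrow> 0"
    by (rule suminf_exist_split2[OF assms])
  \<comment> \<open>The tail after J starts at J + 1, hence the shift by one.\<close>
  hence "(\<lambda>n. \<Sum>j. scaled_count d w (j + Suc n)) \<longlonglongrightarrow> 0" by (rule LIMSEQ_Suc)
  thus ?thesis by (simp add: scaled_count_tail_def[abs_def])
qed

theorem theorem2:
  fixes A :: real and w :: "nat \<Rightarrow> real"
  assumes "A > 1"
    and "\<forall>j. w j \<ge> 0"
    and "summable (scaled_count CARD('d::finite) w)"
  shows "\<forall>\<epsilon>>0.
    (\<exists>J. \<forall>\<pi> \<in> (law_class w A :: ((real ^ 'd) \<times> real) measure set). bayes_approximable \<pi> \<epsilon> J) \<and>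
    (\<exists>J. scaled_count_tail CARD('d) w J < \<epsilon> / A) \<and>
    (\<forall>\<pi> \<in> (law_class w A :: ((real ^ 'd) \<times> real) measure set).
      bayes_approximable \<pi> \<epsilon> (LEAST J. scaled_count_tail CARD('d) w J < \<epsilon> / A))"
proof (intro allI impI)
  fix \<epsilon> :: real assume "\<epsilon> > 0"
  let ?P = "\<lambda>J. scaled_count_tail CARD('d) w J < \<epsilon> / A"
  have "eventually ?P sequentially"
    using \<open>\<epsilon> > 0\<close> \<open>A > 1\<close>
    by (intro order_tendstoD(2)[OF scaled_count_tail_tendsto_0[OF assms(3)]]) simp
  hence ex: "\<exists>J. ?P J" by (auto simp: eventually_sequentially)
  \<comment> \<open>Existence makes the least J satisfy the tail condition; this J also witnesses
    the first conjunct.\<close>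
  hence "?P (LEAST J. ?P J)" by (rule LeastI_ex)
  hence "\<forall>\<pi> \<in> (law_class w A :: ((real ^ 'd) \<times> real) measure set).
      bayes_approximable \<pi> \<epsilon> (LEAST J. ?P J)"
    using assms(1,3) by (auto intro!: law_class_bayes_approximable)
  with ex show "(\<exists>J. \<forall>\<pi> \<in> (law_class w A :: ((real ^ 'd) \<times> real) measure set). bayes_approximable \<pi> \<epsilon> J) \<and>
      (\<exists>J. ?P J) \<and>
      (\<forall>\<pi> \<in> (law_class w A :: ((real ^ 'd) \<times> real) measure set).
        bayes_approximable \<pi> \<epsilon> (LEAST J. ?P J))"
    by blast
qed

end
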